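(* Let $1<p,q<\infty$ with $\frac1p+\frac1q=1$. Let $(\mathcal{M},0)$ be a pointed metric space with metric $d(\cdot,\cdot)$ and let $\mathcal{X}$ be a Banach space over $\mathbb{K}$. Let $\{f_n\}_{n=1}^\infty$ in $\operatorname{Lip}_0(\mathcal{M},\mathbb{K})$ be a pointed Lipschitz $p$-Bessel sequence for $(\mathcal{M},0)$ with bound $b>0$, and let $\{\tau_n\}_{n=1}^\infty$ in $\mathcal{X}$ be a pointed Lipschitz $q$-Bessel sequence for $\operatorname{Lip}_0(\mathcal{X},\mathbb{K})$ with bound $D>0$. If $\{\lambda_n\}_n\in\ell^\infty(\mathbb{N})$, then the map $$T:\mathcal{M}\ni x\mapsto \sum_{n=1}^\infty \lambda_n f_n(x)\tau_n\in\mathcal{X}$$ is well-defined (the series converges in the norm of $\mathcal{X}$ for every $x\in\mathcal{M}$), it is Lipschitz, it satisfies $T0=0$, and its Lipschitz norm satisfies $$\|T\|_{\operatorname{Lip}_0}\le bD\,\|\{\lambda_n\}_n\|_\infty .$$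
   Context: $\mathbb{K}$ denotes $\mathbb{R}$ or $\mathbb{C}$. A pointed metric space $(\mathcal{M},0)$ is a metric space with a distinguished point denoted $0$; a Banach space $\mathcal{X}$ is regarded as a pointed metric space with its zero vector as distinguished point. For a pointed metric space $(\mathcal{M},0)$ and a Banach space $\mathcal{X}$, $\operatorname{Lip}_0(\mathcal{M},\mathcal{X})$ is the Banach space of Lipschitz maps $f:\mathcal{M}\to\mathcal{X}$ with $f(0)=0$, with norm $$\|f\|_{\operatorname{Lip}_0}=\sup_{x,y\in\mathcal{M},\,x\ne y}\frac{\|f(x)-f(y)\|}{d(x,y)}.$$ A sequence $\{f_n\}_n$ in $\operatorname{Lip}_0(\mathcal{M},\mathbb{K})$ is a pointed Lipschitz $p$-Bessel sequence for $(\mathcal{M},0)$ with bound $b>0$ if $$\Big(\sum_{n=1}^\infty|f_n(x)-f_n(y)|^p\Big)^{1/p}\le b\,d(x,y)\quad\text{for all }x,y\in\mathcal{M}.$$ A sequence $\{\tau_n\}_n$ in $\mathcal{X}$ is a pointed Lipschitz $q$-Bessel sequence for $\operatorname{Lip}_0(\mathcal{X},\mathbb{K})$ with bound $D>0$ if $$\Big(\sum_{n=1}^\infty|f(\tau_n)-g(\tau_n)|^q\Big)^{1/q}\le D\,\|f-g\|_{\operatorname{Lip}_0}\quad\text{for all }f,g\in\operatorname{Lip}_0(\mathcal{X},\mathbb{K}).$$ *)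

theory Defs
  imports "HOL-Analysis.Analysis"
begin

text \<open>
  The scalar field is \<open>\<real>\<close> or \<open>\<complex>\<close>. To treat both at once, the class below collects the normed fields
  that are isometrically isomorphic, as normed real algebras, to one of the two. The map \<open>h\<close> is
  the isomorphism onto its image inside the complex numbers.
\<close>

class real_or_complex = real_normed_field +
  assumes real_or_complex_embedding:
    "\<exists>h :: 'a \<Rightarrow> complex.
       (\<forall>x y. h (x + y) = h x + h y) \<and> (\<forall>x y. h (x * y) = h x * h y) \<and>
       (\<forall>r x. h (r *\<^sub>R x) = r *\<^sub>R h x) \<and> (\<forall>x. norm (h x) = norm x) \<and>
       (range h = \<real> \<or> range h = UNIV)"

instance real :: real_or_complex
proof
  show "\<exists>h :: real \<Rightarrow> complex.
       (\<forall>x y. h (x + y) = h x + h y) \<and> (\<forall>x y. h (x * y) = h x * h y) \<and>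
       (\<forall>r x. h (r *\<^sub>R x) = r *\<^sub>R h x) \<and> (\<forall>x. norm (h x) = norm x) \<and>
       (range h = \<real> \<or> range h = UNIV)"
    by (rule exI[of _ complex_of_real]) (simp add: Reals_def scaleR_conv_of_real)
qed

instance complex :: real_or_complex
proof
  show "\<exists>h :: complex \<Rightarrow> complex.
       (\<forall>x y. h (x + y) = h x + h y) \<and> (\<forall>x y. h (x * y) = h x * h y) \<and>
       (\<forall>r x. h (r *\<^sub>R x) = r *\<^sub>R h x) \<and> (\<forall>x. norm (h x) = norm x) \<and>
       (range h = \<real> \<or> range h = UNIV)"
    by (rule exI[of _ "\<lambda>z. z"]) simp
qed

text \<open>
  A normed space over the scalar field: the type class provides the norm and the underlying real
  vector space, and \<open>scale\<close> is the scalar multiplication, which extends the real one. A Banach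
  space over the field is obtained by taking the vector type in class \<open>banach\<close>.
\<close>

locale normed_space_over = vector_space scale
  for scale :: "'k::real_or_complex \<Rightarrow> 'x::real_normed_vector \<Rightarrow> 'x" +
  assumes norm_scale: "norm (scale c x) = norm c * norm x"
    and scale_of_real: "scale (of_real r) x = r *\<^sub>R x"

definition Lip0 :: "'m::metric_space \<Rightarrow> ('m \<Rightarrow> 'x::real_normed_vector) set" where
  "Lip0 z = {f. (\<exists>L. L-lipschitz_on UNIV f) \<and> f z = 0}"

text \<open>
  The supremum is taken in \<open>[0, \<infinity>)\<close>; inserting \<open>0\<close> only matters for a one-point space, where
  there are no pairs of distinct points and \<open>Sup {}\<close> would be unspecified on the reals. The value
  is meaningful only for Lipschitz \<open>f\<close>, for which the set is bounded above.
\<close>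

definition lip0_norm :: "('m::metric_space \<Rightarrow> 'x::real_normed_vector) \<Rightarrow> real" where
  "lip0_norm f = Sup (insert 0 {norm (f x - f y) / dist x y |x y. x \<noteq> y})"

text \<open>
  In the next two definitions summability has to be demanded explicitly, as \<open>suminf\<close> of a divergent
  series is not \<open>\<infinity>\<close> but unspecified.
\<close>

definition lipschitz_bessel_for_space ::
    "real \<Rightarrow> 'm::metric_space \<Rightarrow> (nat \<Rightarrow> 'm \<Rightarrow> 'k::real_or_complex) \<Rightarrow> real \<Rightarrow> bool" where
  "lipschitz_bessel_for_space p z f b \<longleftrightarrow>
     b > 0 \<and> (\<forall>n. f n \<in> Lip0 z) \<and>
     (\<forall>x y. summable (\<lambda>n. norm (f n x - f n y) powr p) \<and>
            (\<Sum>n. norm (f n x - f n y) powr p) powr (1 / p) \<le> b * dist x y)"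

text \<open>The type argument names the scalar field, which does not occur in the type of \<open>\<tau>\<close>.\<close>

definition lipschitz_bessel_for_Lip0 ::
    "'k::real_or_complex itself \<Rightarrow> real \<Rightarrow> (nat \<Rightarrow> 'x::real_normed_vector) \<Rightarrow> real \<Rightarrow> bool" where
  "lipschitz_bessel_for_Lip0 _ q \<tau> D \<longleftrightarrow>
     D > 0 \<and>
     (\<forall>f \<in> Lip0 0. \<forall>g \<in> Lip0 0.
        summable (\<lambda>n. norm (f (\<tau> n) - g (\<tau> n) :: 'k) powr q) \<and>
        (\<Sum>n. norm (f (\<tau> n) - g (\<tau> n)) powr q) powr (1 / q) \<le> D * lip0_norm (\<lambda>x. f x - g x))"

end

(*
  The norm of X, viewed as a scalar-valued function, lies in Lip0 with Lipschitz norm at most 1.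
  Testing the q-Bessel condition on it gives (\<Sum>n. norm (\<tau> n) powr q) powr (1/q) \<le> D, so the series
  converges absolutely by Hoelder's inequality and no duality argument is needed.
*)
theory Submission
  imports Defs
begin

text \<open>Hoelder's inequality for series, by applying Young's inequality to each term after
  dividing the two series by their sums. The resulting majorant is summable, so convergence of the
  product series and the bound come out together.\<close>

lemma Hoelder_suminf:
  fixes a c :: "nat \<Rightarrow> real"
  assumes pq: "p > 0" "q > 0" "1 / p + 1 / q = 1"
    and nn: "\<And>n. a n \<ge> 0" "\<And>n. c n \<ge> 0"
    and sa: "summable (\<lambda>n. a n powr p)" and sc: "summable (\<lambda>n. c n powr q)"
  shows "summable (\<lambda>n. a n * c n)"
    and "(\<Sum>n. a n * c n) \<le> (\<Sum>n. a n powr p) powr (1 / p) * (\<Sum>n. c n powr q) powr (1 / q)"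
proof -
  define A where "A = (\<Sum>n. a n powr p)"
  define C where "C = (\<Sum>n. c n powr q)"
  have A0: "A \<ge> 0" and C0: "C \<ge> 0"
    unfolding A_def C_def by (auto intro!: suminf_nonneg sa sc)
  have "summable (\<lambda>n. a n * c n) \<and> (\<Sum>n. a n * c n) \<le> A powr (1 / p) * C powr (1 / q)"
  proof (cases "A = 0 \<or> C = 0")
    case True
    \<comment> \<open>Division by \<open>A\<close> or \<open>C\<close> is impossible here, but a
      nonnegative series with sum 0 has only zero terms.\<close>
    then have "(\<forall>n. a n = 0) \<or> (\<forall>n. c n = 0)"
      using suminf_eq_zero_iff[OF sa] suminf_eq_zero_iff[OF sc] by (simp add: A_def C_def)
    then have "(\<lambda>n. a n * c n) = (\<lambda>_. 0)" by auto
    then show ?thesis by simp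
  next
    case False
    with A0 C0 have A: "A > 0" and C: "C > 0" by auto
    let ?K = "A powr (1 / p) * C powr (1 / q)"
    \<comment> \<open>The weights are chosen so that the normalised series each sum to 1; hence
      \<open>?u\<close> sums to \<open>?K * (1 / p + 1 / q)\<close>, which is
      \<open>?K\<close>.\<close>
    let ?u = "\<lambda>n. ?K * (1 / p * (a n powr p / A) + 1 / q * (c n powr q / C))"
    have young: "a n * c n \<le> ?u n" for n
    \<comment> \<open>The weighted inequality of means is applied to positive numbers only; if a
      factor vanishes, the left side is 0.\<close>
    proof (cases "a n = 0 \<or> c n = 0")
      case True
      then show ?thesis using pq A C by auto
    next
      case False
      with nn have "a n > 0" "c n > 0" by (auto simp: less_le)
      then have "(a n powr p / A) powr (1 / p) * (c n powr q / C) powr (1 / q)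
          \<le> 1 / p * (a n powr p / A) + 1 / q * (c n powr q / C)"
        using pq A C by (intro Youngs_inequality_0) auto
      moreover have "(a n powr p / A) powr (1 / p) * (c n powr q / C) powr (1 / q) = a n * c n / ?K"
        using pq A C nn by (simp add: powr_divide powr_powr)
      ultimately show ?thesis
        using A C by (simp add: divide_le_eq mult.commute)
    qed
    have "?u sums (?K * (1 / p * (A / A) + 1 / q * (C / C)))"
      unfolding A_def C_def
      by (intro sums_mult sums_add sums_divide summable_sums sa sc)
    then have u: "?u sums ?K" using A C pq by simp
    then have s: "summable (\<lambda>n. a n * c n)"
      using young nn by (intro summable_comparison_test'[OF sums_summable[OF u]]) auto
    with suminf_le[OF young s sums_summable[OF u]] sums_unique[OF u] show ?thesis by simp
  qed
  then show "summable (\<lambda>n. a n * c n)"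
    and "(\<Sum>n. a n * c n) \<le> (\<Sum>n. a n powr p) powr (1 / p) * (\<Sum>n. c n powr q) powr (1 / q)"
    by (simp_all add: A_def C_def)
qed

lemma lip0_norm_le:
  assumes "L-lipschitz_on UNIV f"
  shows "lip0_norm f \<le> L"
  unfolding lip0_norm_def
proof (rule cSup_least)
  fix u assume "u \<in> insert 0 {norm (f x - f y) / dist x y |x y. x \<noteq> y}"
  then show "u \<le> L"
    \<comment> \<open>Nonnegativity of \<open>L\<close> takes care of the element 0 inserted into
      the set.\<close>
    using assms lipschitz_onD[OF assms] lipschitz_on_nonneg[OF assms]
    by (auto simp: divide_le_eq dist_norm)
qed simp

lemma lipschitz_bessel_for_Lip0_norm:
  fixes \<tau> :: "nat \<Rightarrow> 'x::real_normed_vector"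
  assumes "lipschitz_bessel_for_Lip0 TYPE('k::real_or_complex) q \<tau> D"
  shows "summable (\<lambda>n. norm (\<tau> n) powr q)"
    and "(\<Sum>n. norm (\<tau> n) powr q) powr (1 / q) \<le> D"
proof -
  \<comment> \<open>\<open>of_real\<close> carries the norm isometrically into the scalar field, so
    the reverse triangle inequality gives Lipschitz constant 1.\<close>
  let ?N = "\<lambda>x::'x. of_real (norm x) :: 'k"
  have lip: "1-lipschitz_on UNIV ?N"
    by (rule lipschitz_onI)
      (auto simp: dist_norm norm_triangle_ineq3 simp flip: of_real_diff)
  then have "?N \<in> Lip0 0" "(\<lambda>_. 0 :: 'k) \<in> Lip0 (0::'x)"
    using lipschitz_on_constant by (auto simp: Lip0_def)
  \<comment> \<open>The Bessel condition is tested on the pair of \<open>?N\<close> and the zero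
    map.\<close>
  with assms have D: "D > 0" "summable (\<lambda>n. norm (\<tau> n) powr q)"
    "(\<Sum>n. norm (\<tau> n) powr q) powr (1 / q) \<le> D * lip0_norm ?N"
    unfolding lipschitz_bessel_for_Lip0_def by fastforce+
  show "summable (\<lambda>n. norm (\<tau> n) powr q)" by fact
  have "D * lip0_norm ?N \<le> D * 1"
    using D(1) lip0_norm_le[OF lip] by (intro mult_left_mono) auto
  with D(3) show "(\<Sum>n. norm (\<tau> n) powr q) powr (1 / q) \<le> D" by simp
qed

theorem theorem3p7:
  fixes p q b D :: real
    and z :: "'m::metric_space"
    and scale :: "'k::real_or_complex \<Rightarrow> 'x::banach \<Rightarrow> 'x"
    and f :: "nat \<Rightarrow> 'm \<Rightarrow> 'k"
    and \<tau> :: "nat \<Rightarrow> 'x"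
    and lam :: "nat \<Rightarrow> 'k"
  assumes "1 < p" and "1 < q" and "1 / p + 1 / q = 1"
    and "normed_space_over scale"
    and "lipschitz_bessel_for_space p z f b"
    and "lipschitz_bessel_for_Lip0 TYPE('k) q \<tau> D"
    and "bounded (range lam)"
  shows "(\<forall>x. summable (\<lambda>n. scale (lam n * f n x) (\<tau> n))) \<and>
    (let T = (\<lambda>x. \<Sum>n. scale (lam n * f n x) (\<tau> n)) in
       (\<exists>L. L-lipschitz_on UNIV T) \<and> T z = 0 \<and>
       lip0_norm T \<le> b * D * (SUP n. norm (lam n)))"
proof -
  interpret normed_space_over scale by fact
  define S where "S = (SUP n. norm (lam n))"
  define T where "T = (\<lambda>x. \<Sum>n. scale (lam n * f n x) (\<tau> n))"
  \<comment> \<open>Boundedness makes the real supremum \<open>S\<close> a genuine upper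
    bound.\<close>
  have "bdd_above (range (\<lambda>n. norm (lam n)))"
    using \<open>bounded (range lam)\<close> by (auto simp: bounded_iff bdd_above_def)
  then have lam: "norm (lam n) \<le> S" for n
    unfolding S_def by (rule cSUP_upper[OF UNIV_I])
  have S: "S \<ge> 0" using lam[of 0] norm_ge_zero order_trans by blast
  have b: "b > 0" and fz: "f n z = 0"
    and fs: "summable (\<lambda>n. norm (f n x - f n y) powr p)"
    and fb: "(\<Sum>n. norm (f n x - f n y) powr p) powr (1 / p) \<le> b * dist x y" for n x y
    using assms(5) by (auto simp: lipschitz_bessel_for_space_def Lip0_def)
  note \<tau> = lipschitz_bessel_for_Lip0_norm[OF assms(6)]
  have D: "D > 0" using assms(6) by (simp add: lipschitz_bessel_for_Lip0_def)
  have pq: "p > 0" "q > 0" using assms by auto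
  \<comment> \<open>Working with differences serves both convergence and the Lipschitz
    estimate.\<close>
  have term_le: "norm (scale (lam n * (f n x - f n y)) (\<tau> n))
      \<le> S * (norm (f n x - f n y) * norm (\<tau> n))" for n x y
    by (simp add: norm_scale norm_mult mult.assoc mult_right_mono lam)
  note H = Hoelder_suminf[OF pq assms(3) norm_ge_zero norm_ge_zero fs \<tau>(1)]
  have sum_diff: "summable (\<lambda>n. scale (lam n * (f n x - f n y)) (\<tau> n))" for x y
    by (rule summable_comparison_test'[OF summable_mult[OF H(1)] term_le])
  \<comment> \<open>The base point is taken as second argument: since \<open>f n z = 0\<close>, the
    difference series is then the series defining \<open>T x\<close>.\<close>
  have summ: "summable (\<lambda>n. scale (lam n * f n x) (\<tau> n))" for x
    using sum_diff[of x z] by (simp add: fz)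
  have lip: "(b * D * S)-lipschitz_on UNIV T"
  proof (rule lipschitz_onI)
    fix x y
    have "T x - T y = (\<Sum>n. scale (lam n * (f n x - f n y)) (\<tau> n))"
      unfolding T_def by (simp add: suminf_diff summ scale_left_diff_distrib right_diff_distrib)
    also have "norm \<dots> \<le> (\<Sum>n. S * (norm (f n x - f n y) * norm (\<tau> n)))"
      by (rule norm_suminf_le[OF term_le summable_mult[OF H(1)]])
    also have "\<dots> = S * (\<Sum>n. norm (f n x - f n y) * norm (\<tau> n))"
      by (rule suminf_mult[OF H(1)])
    \<comment> \<open>The Hoelder factors are bounded by the two Bessel conditions:
      \<open>b * dist x y\<close> from \<open>f\<close>, and \<open>D\<close> from \<tau>.\<close>
    also have "\<dots> \<le> S * ((b * dist x y) * D)"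
      using b D S by (intro mult_left_mono order_trans[OF H(2)] mult_mono fb \<tau>(2)) auto
    finally show "dist (T x) (T y) \<le> b * D * S * dist x y"
      by (simp add: dist_norm mult_ac)
  qed (use b D S in simp)
  have "T z = 0" by (simp add: T_def fz)
  with summ lip lip0_norm_le[OF lip] show ?thesis
    unfolding T_def S_def Let_def by blast
qed

end
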